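(* Let $\gamma\in(0,1]$, $\kappa\in[0,1)$ and $b>0$. For $a>0$ let $X$ be an $\mathrm{SDS}(\gamma,\lambda,\kappa)$ random variable with $\lambda=b/a^{2\gamma}$, let $X^a=aX$, and let $f^a$ be the characteristic function of $X^a$, that is, $$f^a(t)=\exp\left\{-\lambda\left(1-(1-\kappa)\frac{\cos(at)-\kappa}{\kappa^2-2\kappa\cos(at)+1}\right)^{\gamma}\right\}.$$ Then for every $t\in\mathbb{R}$ $$f^a(t)\longrightarrow\varphi(t)=\exp\left\{-\sigma|t|^{2\gamma}\right\}\qquad\text{as }a\to0,$$ where $\sigma=\dfrac{b}{2^{\gamma}}\dfrac{(1+\kappa)^{\gamma}}{(1-\kappa)^{2\gamma}}$.
   Context: For $\gamma\in(0,1]$, $\lambda>0$, $\kappa\in[0,1)$, $\mathrm{SDS}(\gamma,\lambda,\kappa)$ denotes the distribution on $\mathbb{Z}$ with characteristic function $$f(t)=\exp\left\{-\lambda\left(1-(1-\kappa)\frac{\cos t-\kappa}{\kappa^2-2\kappa\cos t+1}\right)^{\gamma}\right\}.$$ The limit is over $a\downarrow0$. *)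

theory Defs
  imports "HOL-Probability.Probability"
begin

text \<open>
  For \<open>\<kappa> \<in> [0,1)\<close> the base of the power below is nonnegative, and it vanishes
  exactly where \<open>cos t = 1\<close>; there \<open>powr\<close> returns \<open>0\<close>, as intended since \<open>\<gamma> > 0\<close>.
\<close>

definition SDS_char :: "real \<Rightarrow> real \<Rightarrow> real \<Rightarrow> real \<Rightarrow> complex" where
  "SDS_char \<gamma> lam \<kappa> t =
     complex_of_real (exp (- lam *
       (1 - (1 - \<kappa>) * ((cos t - \<kappa>) / (\<kappa>\<^sup>2 - 2 * \<kappa> * cos t + 1))) powr \<gamma>))"

text \<open>
  \<open>SDS \<gamma> lam \<kappa> \<mu>\<close> says that the law \<open>\<mu>\<close> on the integers is the distribution
  \<open>SDS(\<gamma>,\<lambda>,\<kappa>)\<close>.  The library's \<open>char\<close> is for laws on the real line, so \<open>\<mu>\<close> is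
  pushed forward along the inclusion of the integers.  The characteristic function
  determines \<open>\<mu>\<close>.
\<close>

definition SDS :: "real \<Rightarrow> real \<Rightarrow> real \<Rightarrow> int measure \<Rightarrow> bool" where
  "SDS \<gamma> lam \<kappa> \<mu> \<longleftrightarrow>
     prob_space \<mu> \<and> sets \<mu> = UNIV \<and>
     (\<forall>t. char (distr \<mu> borel real_of_int) t = SDS_char \<gamma> lam \<kappa> t)"

definition SDS_rv :: "real \<Rightarrow> real \<Rightarrow> real \<Rightarrow> 'a measure \<Rightarrow> ('a \<Rightarrow> int) \<Rightarrow> bool" where
  "SDS_rv \<gamma> lam \<kappa> M X \<longleftrightarrow>
     prob_space M \<and> X \<in> measurable M (count_space UNIV) \<and>
     SDS \<gamma> lam \<kappa> (distr M (count_space UNIV) X)"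

end

theory Submission imports Defs
begin

text \<open>
  The exponent of the SDS characteristic function rests on the identity
  \<open>1 - (1 - \<kappa>) * ((c - \<kappa>) / (\<kappa>\<^sup>2 - 2 * \<kappa> * c + 1)) = (1 + \<kappa>) * (1 - c) / (\<kappa>\<^sup>2 - 2 * \<kappa> * c + 1)\<close>
  with \<open>c = cos (a t)\<close>,
  which shows that the base of the power is of second order as \<open>a\<close> tends to \<open>0\<close>: the denominator tends
  to \<open>(1-\<kappa>)\<^sup>2\<close>, and \<open>1 - c\<close> behaves like \<open>(a t)\<^sup>2/2\<close>
  (lemmas \<open>SDS_base_eq\<close> and \<open>SDS_base_over_square_tendsto\<close>).
  The scaling \<open>\<lambda> = b/a powr (2 * \<gamma>)\<close> is exactly what is needed to move the factor
  \<open>a\<^sup>2\<close> inside the \<open>\<gamma>\<close>-th power, so the exponent tends to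
  \<open>-b ((1+\<kappa>) t\<^sup>2 / (2 (1-\<kappa>)\<^sup>2)) powr \<gamma> = -\<sigma> \<bar>t\<bar> powr (2 * \<gamma>)\<close>.
  On the probabilistic side, multiplying a random variable by \<open>a\<close> replaces \<open>t\<close> by \<open>a t\<close>
  in its characteristic function (lemma \<open>char_scaled_SDS_rv\<close>).
\<close>

lemma SDS_denominator_pos:
  fixes \<kappa> c :: real
  assumes "0 \<le> \<kappa>" "\<kappa> < 1" "c \<le> 1"
  shows "0 < \<kappa>\<^sup>2 - 2 * \<kappa> * c + 1"
proof -
  have "\<kappa>\<^sup>2 - 2 * \<kappa> * c + 1 = (1 - \<kappa>)\<^sup>2 + 2 * \<kappa> * (1 - c)"
    by (simp add: power2_eq_square algebra_simps)
  moreover have "0 < (1 - \<kappa>)\<^sup>2" "0 \<le> 2 * \<kappa> * (1 - c)"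
    using assms by auto
  ultimately show ?thesis by linarith
qed

lemma SDS_base_eq:
  fixes \<kappa> c :: real
  assumes "0 \<le> \<kappa>" "\<kappa> < 1" "c \<le> 1"
  shows "1 - (1 - \<kappa>) * ((c - \<kappa>) / (\<kappa>\<^sup>2 - 2 * \<kappa> * c + 1))
       = (1 + \<kappa>) * (1 - c) / (\<kappa>\<^sup>2 - 2 * \<kappa> * c + 1)"
  using SDS_denominator_pos[OF assms]
  by (simp add: divide_simps) (simp add: power2_eq_square algebra_simps)

text \<open>
  The half-angle form \<open>1 - cos (a t) = 2 (sin (a t/2))\<^sup>2\<close> reduces this second-order limit
  to the derivative of \<open>\<lambda>a. sin (a t/2)\<close> at \<open>0\<close>.
\<close>

lemma one_minus_cos_over_square_tendsto:
  fixes t :: real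
  shows "((\<lambda>a. (1 - cos (a * t)) / a\<^sup>2) \<longlongrightarrow> t\<^sup>2 / 2) (at 0)"
proof -
  have "((\<lambda>a. sin (a * t / 2)) has_field_derivative t / 2) (at 0)"
    by (auto intro!: derivative_eq_intros)
  then have "((\<lambda>a. sin (a * t / 2) / a) \<longlongrightarrow> t / 2) (at 0)"
    by (simp add: has_field_derivative_iff)
  then have "((\<lambda>a. 2 * (sin (a * t / 2) / a)\<^sup>2) \<longlongrightarrow> 2 * (t / 2)\<^sup>2) (at 0)"
    by (intro tendsto_mult tendsto_power tendsto_const)
  moreover have "2 * (sin (a * t / 2) / a)\<^sup>2 = (1 - cos (a * t)) / a\<^sup>2" for a
    using cos_double_sin[of "a * t / 2"] by (simp add: power_divide)
  moreover have "2 * (t / 2)\<^sup>2 = t\<^sup>2 / 2"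
    by (simp add: power_divide)
  ultimately show ?thesis
    by (simp only:)
qed

lemma SDS_base_over_square_tendsto:
  fixes \<kappa> t :: real
  assumes "0 \<le> \<kappa>" "\<kappa> < 1"
  shows "((\<lambda>a. (1 - (1 - \<kappa>) * ((cos (a * t) - \<kappa>) / (\<kappa>\<^sup>2 - 2 * \<kappa> * cos (a * t) + 1))) / a\<^sup>2)
           \<longlongrightarrow> (1 + \<kappa>) * t\<^sup>2 / (2 * (1 - \<kappa>)\<^sup>2)) (at 0)"
proof -
  have den: "\<kappa>\<^sup>2 - 2 * \<kappa> * cos (0 * t) + 1 = (1 - \<kappa>)\<^sup>2"
    by (simp add: power2_eq_square algebra_simps)
  have "((\<lambda>a. \<kappa>\<^sup>2 - 2 * \<kappa> * cos (a * t) + 1) \<longlongrightarrow> (1 - \<kappa>)\<^sup>2) (at 0)"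
    unfolding den[symmetric] by (intro tendsto_intros)
  then have "((\<lambda>a. (1 + \<kappa>) * ((1 - cos (a * t)) / a\<^sup>2) / (\<kappa>\<^sup>2 - 2 * \<kappa> * cos (a * t) + 1))
           \<longlongrightarrow> (1 + \<kappa>) * (t\<^sup>2 / 2) / (1 - \<kappa>)\<^sup>2) (at 0)"
    using assms(2)
    by (intro tendsto_divide tendsto_mult tendsto_const one_minus_cos_over_square_tendsto) auto
  then show ?thesis
    unfolding SDS_base_eq[OF assms cos_le_one] by (simp add: mult.commute)
qed

lemma char_distr_scale:
  fixes Y :: "'a \<Rightarrow> real"
  assumes "Y \<in> borel_measurable M"
  shows "char (distr M borel (\<lambda>\<omega>. a * Y \<omega>)) t = char (distr M borel Y) (a * t)"
  using assms by (simp add: char_def integral_distr mult_ac)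

lemma char_scaled_SDS_rv:
  assumes "SDS_rv \<gamma> lam \<kappa> M X"
  shows "char (distr M borel (\<lambda>\<omega>. a * real_of_int (X \<omega>))) t = SDS_char \<gamma> lam \<kappa> (a * t)"
proof -
  have X: "X \<in> measurable M (count_space UNIV)"
    and chf: "\<And>s. char (distr (distr M (count_space UNIV) X) borel real_of_int) s
                 = SDS_char \<gamma> lam \<kappa> s"
    using assms by (auto simp: SDS_rv_def SDS_def)
  have "char (distr M borel (\<lambda>\<omega>. a * real_of_int (X \<omega>))) t
      = char (distr M borel (\<lambda>\<omega>. real_of_int (X \<omega>))) (a * t)"
    using X by (intro char_distr_scale) measurable
  also have "distr M borel (\<lambda>\<omega>. real_of_int (X \<omega>))
      = distr (distr M (count_space UNIV) X) borel real_of_int"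
    using X by (simp add: distr_distr comp_def)
  finally show ?thesis
    by (simp add: chf)
qed

lemma square_powr:
  fixes x \<gamma> :: real
  shows "(x\<^sup>2) powr \<gamma> = \<bar>x\<bar> powr (2 * \<gamma>)"
proof -
  have "x\<^sup>2 = \<bar>x\<bar> powr 2"
    by simp
  then show ?thesis
    by (simp only: powr_powr)
qed

lemma stable_scale_eq:
  fixes \<gamma> \<kappa> b t :: real
  assumes "0 \<le> \<kappa>" "\<kappa> < 1"
  shows "b * ((1 + \<kappa>) * t\<^sup>2 / (2 * (1 - \<kappa>)\<^sup>2)) powr \<gamma>
       = b / 2 powr \<gamma> * ((1 + \<kappa>) powr \<gamma> / (1 - \<kappa>) powr (2 * \<gamma>)) * \<bar>t\<bar> powr (2 * \<gamma>)"
  using assms by (simp add: powr_mult powr_divide square_powr)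

text \<open>
  The power \<open>powr\<close> is continuous at the limit even when \<open>t = 0\<close>, where the base is \<open>0\<close>,
  because its exponent is positive and the base is nonnegative.
\<close>

lemma scaled_SDS_char_tendsto:
  fixes \<gamma> \<kappa> b t :: real
  assumes "0 < \<gamma>" "0 \<le> \<kappa>" "\<kappa> < 1"
  shows "((\<lambda>a. SDS_char \<gamma> (b / a powr (2 * \<gamma>)) \<kappa> (a * t)) \<longlongrightarrow>
           complex_of_real (exp (- (b / 2 powr \<gamma> * ((1 + \<kappa>) powr \<gamma> / (1 - \<kappa>) powr (2 * \<gamma>)))
             * \<bar>t\<bar> powr (2 * \<gamma>)))) (at_right 0)"
proof -
  define B where
    "B a = 1 - (1 - \<kappa>) * ((cos (a * t) - \<kappa>) / (\<kappa>\<^sup>2 - 2 * \<kappa> * cos (a * t) + 1))" for a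
  have B_nonneg: "0 \<le> B a" for a
    unfolding B_def SDS_base_eq[OF assms(2,3) cos_le_one]
    using SDS_denominator_pos[OF assms(2,3) cos_le_one, of "a * t"] assms(2) by simp
  have "((\<lambda>a. B a / a\<^sup>2) \<longlongrightarrow> (1 + \<kappa>) * t\<^sup>2 / (2 * (1 - \<kappa>)\<^sup>2)) (at_right 0)"
    unfolding B_def
    by (rule filterlim_mono[OF SDS_base_over_square_tendsto[OF assms(2,3)] order_refl at_le]) simp
  then have "((\<lambda>a. (B a / a\<^sup>2) powr \<gamma>) \<longlongrightarrow> ((1 + \<kappa>) * t\<^sup>2 / (2 * (1 - \<kappa>)\<^sup>2)) powr \<gamma>)
               (at_right 0)"
    using assms(1) B_nonneg by (intro tendsto_powr') (auto intro!: always_eventually)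
  then have "((\<lambda>a. complex_of_real (exp (- (b * (B a / a\<^sup>2) powr \<gamma>)))) \<longlongrightarrow>
      complex_of_real (exp (- (b * ((1 + \<kappa>) * t\<^sup>2 / (2 * (1 - \<kappa>)\<^sup>2)) powr \<gamma>)))) (at_right 0)"
    by (intro tendsto_of_real tendsto_exp tendsto_minus tendsto_mult tendsto_const)
  moreover have "\<forall>\<^sub>F a in at_right 0. complex_of_real (exp (- (b * (B a / a\<^sup>2) powr \<gamma>)))
      = SDS_char \<gamma> (b / a powr (2 * \<gamma>)) \<kappa> (a * t)"
    using eventually_at_right_less[of "0::real"]
  proof eventually_elim
    case (elim a)
    then have "(a\<^sup>2) powr \<gamma> = a powr (2 * \<gamma>)"
      by (simp add: square_powr)
    then show ?case
      unfolding SDS_char_def B_def[symmetric] using B_nonneg[of a] by (simp add: powr_divide)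
  qed
  ultimately show ?thesis
    using stable_scale_eq[OF assms(2,3)] by (simp add: filterlim_cong)
qed

theorem theorem5p6:
  fixes \<gamma> \<kappa> b \<sigma> :: real
    and lam :: "real \<Rightarrow> real"
    and M :: "real \<Rightarrow> 'a measure"
    and X :: "real \<Rightarrow> 'a \<Rightarrow> int"
    and f :: "real \<Rightarrow> real \<Rightarrow> complex"
  assumes "0 < \<gamma>" "\<gamma> \<le> 1" "0 \<le> \<kappa>" "\<kappa> < 1" "0 < b"
    and "\<And>a. a > 0 \<Longrightarrow> lam a = b / a powr (2 * \<gamma>)"
    and "\<And>a. a > 0 \<Longrightarrow> SDS_rv \<gamma> (lam a) \<kappa> (M a) (X a)"
    and "\<And>a t. a > 0 \<Longrightarrow> f a t = char (distr (M a) borel (\<lambda>\<omega>. a * real_of_int (X a \<omega>))) t"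
    and "\<sigma> = b / 2 powr \<gamma> * ((1 + \<kappa>) powr \<gamma> / (1 - \<kappa>) powr (2 * \<gamma>))"
  shows "(\<forall>a>0. \<forall>t. f a t = complex_of_real (exp (- lam a *
            (1 - (1 - \<kappa>) * ((cos (a * t) - \<kappa>) / (\<kappa>\<^sup>2 - 2 * \<kappa> * cos (a * t) + 1))) powr \<gamma>)))
       \<and> (\<forall>t. ((\<lambda>a. f a t) \<longlongrightarrow> complex_of_real (exp (- \<sigma> * \<bar>t\<bar> powr (2 * \<gamma>)))) (at_right 0))"
proof (intro conjI allI impI)
  have f_eq: "f a t = SDS_char \<gamma> (lam a) \<kappa> (a * t)" if "a > 0" for a t
    using that assms(7,8) by (simp add: char_scaled_SDS_rv)
  show "f a t = complex_of_real (exp (- lam a *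
            (1 - (1 - \<kappa>) * ((cos (a * t) - \<kappa>) / (\<kappa>\<^sup>2 - 2 * \<kappa> * cos (a * t) + 1))) powr \<gamma>))"
    if "a > 0" for a t
    using f_eq[OF that] by (simp add: SDS_char_def)
  show "((\<lambda>a. f a t) \<longlongrightarrow> complex_of_real (exp (- \<sigma> * \<bar>t\<bar> powr (2 * \<gamma>)))) (at_right 0)" for t
  proof (rule Lim_transform_eventually)
    show "((\<lambda>a. SDS_char \<gamma> (b / a powr (2 * \<gamma>)) \<kappa> (a * t)) \<longlongrightarrow>
             complex_of_real (exp (- \<sigma> * \<bar>t\<bar> powr (2 * \<gamma>)))) (at_right 0)"
      unfolding assms(9) using assms(1,3,4) by (rule scaled_SDS_char_tendsto)
    show "\<forall>\<^sub>F a in at_right 0. SDS_char \<gamma> (b / a powr (2 * \<gamma>)) \<kappa> (a * t) = f a t"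
      using eventually_at_right_less[of "0::real"]
      by eventually_elim (simp add: f_eq assms(6))
  qed
qed

end
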